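(* Let $E,F\in\mathbb{C}^{n\times n}$ be (Hermitian) positive definite matrices and let $A\in\mathbb{C}^{n\times n}$ with $\mathrm{ind}(A)=k$. Then for any positive integer $m$ satisfying $m\geq k$: (i) $A^{\mathrm{ep},E}=A^m(A^{m+1})^{\mathrm{core},E}=A^m(A^{m+1})^{\dagger}_{E,I}$. (ii) $A^{F,\mathrm{ep}}=(A^{m+1})^{F,\mathrm{core}}A^m=(A^{m+1})^{\dagger}_{I,F}A^m$.
   Context: The index $\mathrm{ind}(A)$ is the smallest non-negative integer $k$ with $\mathrm{rank}(A^k)=\mathrm{rank}(A^{k+1})$ (with $A^0=I$). For invertible Hermitian $E,F$ and a square matrix $B$: $B^\dagger_{E,F}$ (generalized weighted Moore-Penrose inverse) is the matrix $Y$, unique when it exists, with $BYB=B$, $YBY=Y$, $(EBY)^*=EBY$, $(FYB)^*=FYB$; the $E$-weighted core inverse $B^{\mathrm{core},E}$ is the matrix $Y$, unique when it exists, with $YB^2=B$, $BY^2=Y$, $(EBY)^*=EBY$; the $F$-weighted dual core inverse $B^{F,\mathrm{core}}$ is the matrix $Y$, unique when it exists, with $B^2Y=B$, $Y^2B=Y$, $(FYB)^*=FYB$. $I$ is the identity matrix. With $k=\mathrm{ind}(A)$: the $E$-weighted core-EP inverse $A^{\mathrm{ep},E}$ is the matrix $X\in\mathbb{C}^{n\times n}$ (unique when it exists) with $XA^{k+1}=A^k$, $AX^2=X$, $(EAX)^*=EAX$; the $F$-weighted dual core-EP inverse $A^{F,\mathrm{ep}}$ is the matrix $X\in\mathbb{C}^{n\times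 n}$ (unique when it exists) with $A^{k+1}X=A^k$, $X^2A=X$, $(FXA)^*=FXA$. The equalities are understood to include the assertion that the inverses appearing in them exist. *)

theory Defs
  imports "HOL-Analysis.Analysis"
begin

(* The operation ^ on complex^'n^'n is the componentwise power, so the matrix power
   is defined separately. *)
primrec matrix_pow :: "'a::semiring_1^'n^'n \<Rightarrow> nat \<Rightarrow> 'a^'n^'n" (infixr "^^\<^sub>m" 80) where
  "A ^^\<^sub>m 0 = mat 1"
| "A ^^\<^sub>m Suc k = A ** (A ^^\<^sub>m k)"

definition conj_transpose :: "complex^'n^'m \<Rightarrow> complex^'m^'n" where
  "conj_transpose A = (\<chi> i j. cnj (A $ j $ i))"

definition hermitian :: "complex^'n^'n \<Rightarrow> bool" where
  "hermitian A \<longleftrightarrow> conj_transpose A = A"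

(* For Hermitian M the number x^* M x is real, so Re loses nothing. *)
definition positive_definite :: "complex^'n^'n \<Rightarrow> bool" where
  "positive_definite M \<longleftrightarrow>
     hermitian M \<and> (\<forall>x. x \<noteq> 0 \<longrightarrow> 0 < Re (\<Sum>i\<in>UNIV. cnj (x $ i) * (M *v x) $ i))"

definition matrix_index :: "complex^'n^'n \<Rightarrow> nat" where
  "matrix_index A = (LEAST k. rank (A ^^\<^sub>m k) = rank (A ^^\<^sub>m (k + 1)))"

(* Each generalized inverse comes as a predicate on candidates Y and as the operator
   selecting the candidate.  The operator is meaningful only if exactly one candidate
   exists; statements about it have to assert this separately. *)

definition is_weighted_MP_inverse ::
  "complex^'n^'n \<Rightarrow> complex^'n^'n \<Rightarrow> complex^'n^'n \<Rightarrow> complex^'n^'n \<Rightarrow> bool" where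
  "is_weighted_MP_inverse E F B Y \<longleftrightarrow>
     B ** Y ** B = B \<and> Y ** B ** Y = Y \<and> hermitian (E ** B ** Y) \<and> hermitian (F ** Y ** B)"

definition weighted_MP_inverse ::
  "complex^'n^'n \<Rightarrow> complex^'n^'n \<Rightarrow> complex^'n^'n \<Rightarrow> complex^'n^'n" where
  "weighted_MP_inverse E F B = (THE Y. is_weighted_MP_inverse E F B Y)"

definition is_weighted_core_inverse ::
  "complex^'n^'n \<Rightarrow> complex^'n^'n \<Rightarrow> complex^'n^'n \<Rightarrow> bool" where
  "is_weighted_core_inverse E B Y \<longleftrightarrow>
     Y ** (B ^^\<^sub>m 2) = B \<and> B ** (Y ^^\<^sub>m 2) = Y \<and> hermitian (E ** B ** Y)"

definition weighted_core_inverse ::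
  "complex^'n^'n \<Rightarrow> complex^'n^'n \<Rightarrow> complex^'n^'n" where
  "weighted_core_inverse E B = (THE Y. is_weighted_core_inverse E B Y)"

definition is_weighted_dual_core_inverse ::
  "complex^'n^'n \<Rightarrow> complex^'n^'n \<Rightarrow> complex^'n^'n \<Rightarrow> bool" where
  "is_weighted_dual_core_inverse F B Y \<longleftrightarrow>
     (B ^^\<^sub>m 2) ** Y = B \<and> (Y ^^\<^sub>m 2) ** B = Y \<and> hermitian (F ** Y ** B)"

definition weighted_dual_core_inverse ::
  "complex^'n^'n \<Rightarrow> complex^'n^'n \<Rightarrow> complex^'n^'n" where
  "weighted_dual_core_inverse F B = (THE Y. is_weighted_dual_core_inverse F B Y)"

definition is_weighted_core_EP_inverse ::
  "complex^'n^'n \<Rightarrow> complex^'n^'n \<Rightarrow> complex^'n^'n \<Rightarrow> bool" where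
  "is_weighted_core_EP_inverse E A X \<longleftrightarrow>
     X ** (A ^^\<^sub>m (matrix_index A + 1)) = A ^^\<^sub>m matrix_index A \<and>
     A ** (X ^^\<^sub>m 2) = X \<and> hermitian (E ** A ** X)"

definition weighted_core_EP_inverse ::
  "complex^'n^'n \<Rightarrow> complex^'n^'n \<Rightarrow> complex^'n^'n" where
  "weighted_core_EP_inverse E A = (THE X. is_weighted_core_EP_inverse E A X)"

definition is_weighted_dual_core_EP_inverse ::
  "complex^'n^'n \<Rightarrow> complex^'n^'n \<Rightarrow> complex^'n^'n \<Rightarrow> bool" where
  "is_weighted_dual_core_EP_inverse F A X \<longleftrightarrow>
     (A ^^\<^sub>m (matrix_index A + 1)) ** X = A ^^\<^sub>m matrix_index A \<and>
     (X ^^\<^sub>m 2) ** A = X \<and> hermitian (F ** X ** A)"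

definition weighted_dual_core_EP_inverse ::
  "complex^'n^'n \<Rightarrow> complex^'n^'n \<Rightarrow> complex^'n^'n" where
  "weighted_dual_core_EP_inverse F A = (THE X. is_weighted_dual_core_EP_inverse F A X)"

end

theory Submission
  imports Defs
begin

text \<open>Put \<open>B = A\<^sup>m\<^sup>+\<^sup>1\<close>. Since \<open>m \<ge> ind A\<close>, one has \<open>A\<^sup>m = T B\<close> and \<open>A\<^sup>m = B S\<close> for suitable \<open>T\<close>, \<open>S\<close>.
  Hence \<open>X = A\<^sup>m Y\<close> satisfies the three equations of the weighted core-EP inverse as soon as
  \<open>B Y B = B\<close> and \<open>E B Y\<close> is Hermitian. Both the weighted core inverse and the weighted Moore-Penrose
  inverse of \<open>B\<close> are such \<open>Y\<close>, so (i) follows from uniqueness of the core-EP inverse. Uniqueness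
  always comes down to the fact that a self-adjoint projector is determined by its range or its kernel.
  Part (ii) is part (i) for the conjugate transpose of \<open>A\<close> and the weight \<open>F\<^sup>-\<^sup>1\<close>.\<close>

section \<open>Matrix powers and conjugate transposes\<close>

lemma matrix_pow_add: "A ^^\<^sub>m (i + j) = (A ^^\<^sub>m i) ** (A ^^\<^sub>m j)"
  by (induction i) (simp_all add: matrix_mul_assoc)

lemma matrix_pow_1 [simp]: "A ^^\<^sub>m 1 = A" "A ^^\<^sub>m Suc 0 = A"
  by simp_all

lemma matrix_pow_2: "A ^^\<^sub>m 2 = A ** A"
  by (simp add: numeral_2_eq_2)

lemma matrix_pow_Suc_right: "A ^^\<^sub>m Suc j = (A ^^\<^sub>m j) ** A"
  using matrix_pow_add[of A j 1] by simp

lemma transpose_matrix_pow: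
  fixes A :: "'a::comm_semiring_1^'n^'n"
  shows "transpose (A ^^\<^sub>m j) = transpose A ^^\<^sub>m j"
proof (induction j)
  case (Suc j)
  then show ?case
    by (metis matrix_pow_Suc_right matrix_transpose_mul matrix_pow.simps(2))
qed (simp add: transpose_mat)

lemma conj_transpose_nth [simp]: "conj_transpose A $ i $ j = cnj (A $ j $ i)"
  by (simp add: conj_transpose_def)

lemma conj_transpose_conj_transpose [simp]: "conj_transpose (conj_transpose A) = A"
  by (simp add: vec_eq_iff)

lemma conj_transpose_mult: "conj_transpose (A ** B) = conj_transpose B ** conj_transpose A"
  by (simp add: vec_eq_iff matrix_matrix_mult_def mult.commute)

lemma conj_transpose_mat_1 [simp]: "conj_transpose (mat 1) = mat 1"
  by (simp add: vec_eq_iff mat_def)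

lemma conj_transpose_matrix_pow: "conj_transpose (A ^^\<^sub>m j) = conj_transpose A ^^\<^sub>m j"
proof (induction j)
  case (Suc j)
  then show ?case
    by (metis matrix_pow_Suc_right conj_transpose_mult matrix_pow.simps(2))
qed simp

lemma conj_transpose_adjoint:
  "(\<Sum>i\<in>UNIV. cnj ((A *v x) $ i) * y $ i) = (\<Sum>j\<in>UNIV. cnj (x $ j) * (conj_transpose A *v y) $ j)"
proof -
  have "(\<Sum>i\<in>UNIV. cnj ((A *v x) $ i) * y $ i) = (\<Sum>i\<in>UNIV. \<Sum>j\<in>UNIV. cnj (x $ j) * (cnj (A $ i $ j) * y $ i))"
    by (simp add: matrix_vector_mult_def sum_distrib_right sum_distrib_left mult_ac)
  also have "\<dots> = (\<Sum>j\<in>UNIV. \<Sum>i\<in>UNIV. cnj (x $ j) * (cnj (A $ i $ j) * y $ i))"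
    by (rule sum.swap)
  also have "\<dots> = (\<Sum>j\<in>UNIV. cnj (x $ j) * (conj_transpose A *v y) $ j)"
    by (simp add: matrix_vector_mult_def sum_distrib_left)
  finally show ?thesis .
qed

section \<open>Column spaces, factorizations and rank\<close>

lemma span_columns_eq_range:
  fixes A :: "'a::field^'n^'m"
  shows "vec.span (columns A) = range ((*v) A)"
proof
  have "column j A \<in> range ((*v) A)" for j
    by (rule range_eqI[of _ _ "axis j 1"])
       (simp add: vec_eq_iff column_def matrix_vector_mult_def axis_def if_distrib cong: if_cong)
  then show "vec.span (columns A) \<subseteq> range ((*v) A)"
    by (intro vec.span_minimal vec.linear_subspace_image) (auto simp: columns_def)
  show "range ((*v) A) \<subseteq> vec.span (columns A)"
    using matrix_vector_mult_in_columnspace_gen by blast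
qed

text \<open>A linear section of the map \<open>A\<close> over its range, taken as a matrix, is such
  a \<open>W\<close>.\<close>

lemma inner_inverse_exists:
  fixes A :: "'a::field^'n^'m"
  shows "\<exists>W. A ** W ** A = A"
proof -
  obtain g where g: "Vector_Spaces.linear (*s) (*s) g" "\<And>v. v \<in> range ((*v) A) \<Longrightarrow> A *v g v = v"
    using vec.linear_exists_right_inverse_on[OF matrix_vector_mul_linear_gen vec.subspace_UNIV, of A] by auto
  have "A ** matrix g ** A = A"
    unfolding matrix_eq using g by (simp add: matrix_vector_mul_assoc[symmetric] matrix_works)
  then show ?thesis by blast
qed

text \<open>\<open>P ** W\<close> fixes the range of \<open>P\<close>, which contains that of
  \<open>Q\<close>, so \<open>T = W ** Q\<close> works.\<close>

lemma matrix_factor_if_range_subset: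
  fixes P :: "'a::field^'n^'m" and Q :: "'a^'l^'m"
  assumes "range ((*v) Q) \<subseteq> range ((*v) P)"
  shows "\<exists>T. Q = P ** T"
proof -
  obtain W where W: "P ** W ** P = P"
    using inner_inverse_exists by blast
  have "Q *v x = (P ** (W ** Q)) *v x" for x
  proof -
    obtain y where "Q *v x = P *v y"
      using assms by blast
    then show ?thesis
      by (metis W matrix_vector_mul_assoc)
  qed
  then show ?thesis
    unfolding matrix_eq by blast
qed

lemma rank_eq_dim_range_transpose:
  fixes A :: "'a::field^'n^'m"
  shows "rank A = vec.dim (range ((*v) (transpose A)))"
  unfolding row_rank_def_gen
  by (metis columns_transpose span_columns_eq_range vec.dim_span)

lemma range_matrix_mult_subset: "range ((*v) (A ** B)) \<subseteq> range ((*v) A)"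
  by (auto simp: matrix_vector_mul_assoc[symmetric])

lemma rank_mult_le:
  fixes P :: "'a::field^'n^'m" and Q :: "'a^'l^'n"
  shows "rank (P ** Q) \<le> rank Q"
  unfolding rank_eq_dim_range_transpose matrix_transpose_mul
  by (intro vec.dim_subset range_matrix_mult_subset)

text \<open>The row space of \<open>P ** Q\<close> lies in that of \<open>Q\<close>. Equal
  dimensions force equality, so the rows of \<open>Q\<close> are combinations of the rows of
  \<open>P ** Q\<close>.\<close>

lemma rank_mult_eq_iff:
  fixes P :: "'a::field^'n^'m" and Q :: "'a^'l^'n"
  shows "rank (P ** Q) = rank Q \<longleftrightarrow> (\<exists>T. Q = T ** (P ** Q))"
proof
  assume eq: "rank (P ** Q) = rank Q"
  have "range ((*v) (transpose (P ** Q))) = range ((*v) (transpose Q))"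
    using eq unfolding rank_eq_dim_range_transpose
    by (intro vec.subspace_dim_equal vec.linear_subspace_image)
       (simp_all only: matrix_transpose_mul range_matrix_mult_subset matrix_vector_mul_linear_gen
         vec.subspace_UNIV order_refl)
  then obtain T where "transpose Q = transpose (P ** Q) ** T"
    using matrix_factor_if_range_subset[of "transpose Q" "transpose (P ** Q)"] by auto
  then have "Q = transpose T ** (P ** Q)"
    by (metis matrix_transpose_mul transpose_transpose)
  then show "\<exists>T. Q = T ** (P ** Q)" ..
next
  assume "\<exists>T. Q = T ** (P ** Q)"
  then show "rank (P ** Q) = rank Q"
    by (metis le_antisym rank_mult_le)
qed

section \<open>Stabilization of powers and the index\<close>

lemma rank_matrix_pow_eq_iff:
  fixes A :: "'a::field^'n^'n"
  shows "rank (A ^^\<^sub>m j) = rank (A ^^\<^sub>m (j + 1)) \<longleftrightarrow> (\<exists>T. A ^^\<^sub>m j = T ** (A ^^\<^sub>m Suc j))"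
  using rank_mult_eq_iff[of A "A ^^\<^sub>m j"] by auto

text \<open>At a power of least rank, one more factor cannot lower the rank.\<close>

lemma left_stable_exists:
  fixes A :: "'a::field^'n^'n"
  shows "\<exists>j T. A ^^\<^sub>m j = T ** (A ^^\<^sub>m Suc j)"
proof -
  obtain j where j: "\<And>i. rank (A ^^\<^sub>m j) \<le> rank (A ^^\<^sub>m i)"
    using ex_has_least_nat[of "\<lambda>_. True" 0 "\<lambda>i. rank (A ^^\<^sub>m i)"] by auto
  have "rank (A ^^\<^sub>m j) = rank (A ^^\<^sub>m (j + 1))"
    using j[of "j + 1"] rank_mult_le[of A "A ^^\<^sub>m j"] by auto
  then show ?thesis
    unfolding rank_matrix_pow_eq_iff by blast
qed

text \<open>The hypothesis is substituted into itself, each time adding a \<open>T\<close> on the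
  left and an \<open>A\<close> on the right.\<close>

lemma left_stable_add:
  assumes "A ^^\<^sub>m k = T ** (A ^^\<^sub>m Suc k)"
  shows "A ^^\<^sub>m k = (T ^^\<^sub>m i) ** (A ^^\<^sub>m (k + i))"
proof (induction i)
  case (Suc i)
  have "A ^^\<^sub>m (k + i) = T ** (A ^^\<^sub>m (k + Suc i))"
    using assms matrix_pow_add[of A k i] matrix_pow_add[of A "Suc k" i]
    by (metis add_Suc_right add_Suc matrix_mul_assoc)
  then show ?case
    using Suc.IH by (metis matrix_pow_Suc_right matrix_mul_assoc)
qed simp

lemma right_stable_transpose:
  fixes A :: "'a::field^'n^'n"
  shows "(\<exists>S. transpose A ^^\<^sub>m k = (transpose A ^^\<^sub>m Suc k) ** S) \<longleftrightarrow> (\<exists>T. A ^^\<^sub>m k = T ** (A ^^\<^sub>m Suc k))"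
  unfolding transpose_matrix_pow[symmetric]
  by (metis matrix_transpose_mul transpose_transpose)

text \<open>Left stability is equality of row ranks of consecutive powers. Since \<open>rank\<close> is the row rank and
  its invariance under transposition is only available over the reals, right stability is first
  obtained at some large exponent and then pulled back along \<open>A\<^sup>k = T\<^sup>j A\<^sup>k\<^sup>+\<^sup>j\<close>.\<close>

lemma left_stable_imp_right_stable:
  fixes A :: "'a::field^'n^'n"
  assumes T: "A ^^\<^sub>m k = T ** (A ^^\<^sub>m Suc k)"
  shows "\<exists>S. A ^^\<^sub>m k = (A ^^\<^sub>m Suc k) ** S"
proof -
  obtain j S where "A ^^\<^sub>m j = (A ^^\<^sub>m Suc j) ** S"
    using left_stable_exists[of "transpose A"] right_stable_transpose[of "transpose A"]
    by (metis transpose_transpose)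
  then have S: "A ^^\<^sub>m (k + j) = (A ^^\<^sub>m Suc (k + j)) ** S"
    by (metis add_Suc_right matrix_mul_assoc matrix_pow_add)
  have "A ^^\<^sub>m k = (T ^^\<^sub>m j) ** (A ^^\<^sub>m (k + j))"
    by (rule left_stable_add[OF T])
  \<comment> \<open>\<open>S\<close> makes \<open>A ** S\<close> a right unit for
    \<open>A^(k+j)\<close>, hence also for \<open>A^k = T^j A^(k+j)\<close>.\<close>
  also have "\<dots> = ((T ^^\<^sub>m j) ** (A ^^\<^sub>m (k + j))) ** (A ** S)"
    by (metis S matrix_mul_assoc matrix_pow_Suc_right)
  also have "\<dots> = (A ^^\<^sub>m Suc k) ** S"
    unfolding left_stable_add[OF T, of j, symmetric] by (simp only: matrix_pow_Suc_right matrix_mul_assoc)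
  finally show ?thesis by blast
qed

lemma left_stable_iff_right_stable:
  fixes A :: "'a::field^'n^'n"
  shows "(\<exists>T. A ^^\<^sub>m k = T ** (A ^^\<^sub>m Suc k)) \<longleftrightarrow> (\<exists>S. A ^^\<^sub>m k = (A ^^\<^sub>m Suc k) ** S)"
  by (metis left_stable_imp_right_stable right_stable_transpose transpose_transpose)

lemma matrix_index_eq: "matrix_index A = (LEAST k. \<exists>T. A ^^\<^sub>m k = T ** (A ^^\<^sub>m Suc k))"
  by (simp only: matrix_index_def rank_matrix_pow_eq_iff)

text \<open>Conjugate transposition exchanges left and right stability, which agree at each
  exponent.\<close>

lemma matrix_index_conj_transpose: "matrix_index (conj_transpose A) = matrix_index A"
proof -
  have "(\<exists>T. conj_transpose A ^^\<^sub>m k = T ** (conj_transpose A ^^\<^sub>m Suc k)) \<longleftrightarrow>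
    (\<exists>S. A ^^\<^sub>m k = (A ^^\<^sub>m Suc k) ** S)" for k
    unfolding conj_transpose_matrix_pow[symmetric]
    by (metis conj_transpose_mult conj_transpose_conj_transpose)
  then show ?thesis
    by (simp only: matrix_index_eq left_stable_iff_right_stable)
qed

text \<open>The index is itself a left stable exponent; right multiplication by powers of
  \<open>A\<close> carries this up to \<open>m\<close>.\<close>

lemma left_stable_matrix_index:
  assumes "matrix_index A \<le> m"
  shows "\<exists>T. A ^^\<^sub>m m = T ** (A ^^\<^sub>m Suc m)"
proof -
  have "\<exists>T. A ^^\<^sub>m matrix_index A = T ** (A ^^\<^sub>m Suc (matrix_index A))"
    unfolding matrix_index_eq using left_stable_exists by (rule LeastI_ex)
  then show ?thesis
    using assms by (metis le_add_diff_inverse add_Suc matrix_mul_assoc matrix_pow_add)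
qed

section \<open>Positive definite weights\<close>

lemma positive_definite_hermitian: "positive_definite E \<Longrightarrow> conj_transpose E = E"
  by (simp add: positive_definite_def hermitian_def)

lemma positive_definite_eq_0:
  assumes "positive_definite E" "(\<Sum>i\<in>UNIV. cnj (x $ i) * (E *v x) $ i) = 0"
  shows "x = 0"
  using assms unfolding positive_definite_def by (metis less_irrefl zero_complex.sel(1))

lemma positive_definite_mat_1: "positive_definite (mat 1 :: complex^'n^'n)"
proof -
  have "0 < Re (\<Sum>i\<in>UNIV. cnj (x $ i) * x $ i)" if "x \<noteq> 0" for x :: "complex^'n"
  proof -
    obtain i where "x $ i \<noteq> 0"
      using \<open>x \<noteq> 0\<close> unfolding vec_eq_iff by auto
    then have "0 < (\<Sum>i\<in>UNIV. (cmod (x $ i))\<^sup>2)"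
      by (intro sum_pos2[where i = i]) auto
    then show ?thesis
      by (simp add: cmod_power2 flip: power2_eq_square)
  qed
  then show ?thesis
    by (simp add: positive_definite_def hermitian_def)
qed

text \<open>Definiteness makes the kernel of \<open>E\<close> trivial. With \<open>x = E y\<close>,
  the form of \<open>G\<close> at \<open>x\<close> is the form of \<open>E\<close> at
  \<open>y\<close>.\<close>

lemma positive_definite_inverse:
  assumes "positive_definite E"
  obtains G where "positive_definite G" "E ** G = mat 1" "G ** E = mat 1"
proof -
  have "x = 0" if "E *v x = 0" for x
    using positive_definite_eq_0[OF assms] that by simp
  then obtain G where GE: "G ** E = mat 1"
    using matrix_left_invertible_ker by blast
  then have EG: "E ** G = mat 1"
    using matrix_left_right_inverse by blast
  have "conj_transpose G = G"
    by (metis EG GE assms conj_transpose_mat_1 conj_transpose_mult matrix_mul_assoc matrix_mul_lid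
        matrix_mul_rid positive_definite_hermitian)
  moreover have "0 < Re (\<Sum>i\<in>UNIV. cnj (x $ i) * (G *v x) $ i)" if "x \<noteq> 0" for x
  proof -
    have x: "x = E *v (G *v x)"
      by (simp add: EG matrix_vector_mul_assoc)
    then have "G *v x \<noteq> 0"
      using that by auto
    then have "0 < Re (\<Sum>i\<in>UNIV. cnj ((G *v x) $ i) * (E *v (G *v x)) $ i)"
      using assms by (simp add: positive_definite_def)
    then show ?thesis
      using conj_transpose_adjoint[of E "G *v x" "G *v x"] x assms
      by (simp add: positive_definite_hermitian)
  qed
  ultimately have "positive_definite G"
    unfolding positive_definite_def hermitian_def by blast
  then show thesis
    using EG GE that by blast
qed

lemma positive_definite_mult_cancel:
  assumes "positive_definite E" "E ** P = E ** Q"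
  shows "P = Q"
  by (metis assms matrix_mul_assoc matrix_mul_lid positive_definite_inverse)

section \<open>Normal equations and least squares inverses\<close>

text \<open>Pairing \<open>B* E B v = 0\<close> with \<open>v\<close> gives the form of
  \<open>E\<close> at \<open>B v\<close>, so \<open>B v = 0\<close>.\<close>

lemma normal_matrix_cancel:
  assumes E: "positive_definite E"
    and eq: "conj_transpose B ** E ** B ** X = conj_transpose B ** E ** B ** Y"
  shows "B ** X = B ** Y"
  unfolding matrix_eq
proof
  fix x
  define v where "v = X *v x - Y *v x"
  have "conj_transpose B *v (E *v (B *v v)) = 0"
    using arg_cong[OF eq, of "\<lambda>M. M *v x"]
    by (simp add: v_def matrix_vector_mul_assoc[symmetric] matrix_vector_mult_diff_distrib)
  then have "B *v v = 0"
    using conj_transpose_adjoint[of B v "E *v (B *v v)"] positive_definite_eq_0[OF E] by simp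
  then show "(B ** X) *v x = (B ** Y) *v x"
    by (simp add: v_def matrix_vector_mul_assoc[symmetric] matrix_vector_mult_diff_distrib)
qed

text \<open>The witness solves the normal equations \<open>B\<^sup>* E B Z = B\<^sup>* E\<close>.\<close>

lemma least_squares_inverse_exists:
  assumes E: "positive_definite E"
  shows "\<exists>Z. B ** Z ** B = B \<and> hermitian (E ** B ** Z)"
proof -
  let ?H = conj_transpose
  note H = conj_transpose_mult positive_definite_hermitian[OF E]
  obtain W where W: "?H B ** E ** B ** W ** (?H B ** E ** B) = ?H B ** E ** B"
    using inner_inverse_exists by blast
  have 1: "B ** (W ** ?H B ** E ** B) = B ** mat 1"
    by (rule normal_matrix_cancel[OF E]) (use W in \<open>simp add: matrix_mul_assoc\<close>)
  then have BWB: "B ** W ** ?H B ** E ** B = B"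
    by (simp add: matrix_mul_assoc)
  have HBWB: "?H B ** E ** B ** ?H W ** ?H B = ?H B"
    using arg_cong[OF BWB, of ?H] by (simp add: H matrix_mul_assoc)
  \<comment> \<open>The same cancellation for the adjoint of \<open>W\<close>, which is again an
    inner inverse of \<open>B* E B\<close>.\<close>
  have 2: "B ** (?H W ** ?H B ** E ** B) = B ** mat 1"
    by (rule normal_matrix_cancel[OF E]) (use HBWB in \<open>simp add: matrix_mul_assoc\<close>)
  \<comment> \<open>Expanding \<open>B*\<close> by \<open>HBWB\<close> and then contracting by
    \<open>BWB\<close> trades \<open>W\<close> for its adjoint.\<close>
  have "?H (E ** B ** (?H W ** ?H B ** E)) = E ** B ** W ** ?H B ** E"
    by (simp add: H matrix_mul_assoc)
  also have "\<dots> = E ** (B ** W ** (?H B ** E ** B ** ?H W ** ?H B)) ** E"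
    by (simp add: HBWB matrix_mul_assoc)
  also have "\<dots> = E ** (B ** W ** ?H B ** E ** B) ** ?H W ** ?H B ** E"
    by (simp only: matrix_mul_assoc)
  also have "\<dots> = E ** B ** (?H W ** ?H B ** E)"
    by (simp only: BWB) (simp only: matrix_mul_assoc)
  finally have "hermitian (E ** B ** (?H W ** ?H B ** E))"
    by (simp add: hermitian_def)
  moreover have "B ** (?H W ** ?H B ** E) ** B = B"
    using 2 by (simp add: matrix_mul_assoc)
  ultimately show ?thesis
    by blast
qed

section \<open>Self-adjoint projectors and the weighted Moore-Penrose inverse\<close>

text \<open>Congruence by \<open>G\<close> turns \<open>F ** M\<close> into \<open>M ** G\<close>,
  whose conjugate transpose is \<open>G ** conj_transpose M\<close>.\<close>

lemma hermitian_conj_transpose_inverse_iff: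
  assumes F: "conj_transpose F = F" and G: "conj_transpose G = G" "F ** G = mat 1" "G ** F = mat 1"
  shows "hermitian (F ** M) \<longleftrightarrow> hermitian (G ** conj_transpose M)"
  unfolding hermitian_def conj_transpose_mult conj_transpose_conj_transpose F G(1)
  by (metis G(2,3) matrix_mul_assoc matrix_mul_lid matrix_mul_rid)

lemma hermitian_mult_swap:
  assumes E: "conj_transpose E = E" and P: "hermitian (E ** P)" and Q: "hermitian (E ** Q)"
  shows "E ** (P ** Q) = conj_transpose (Q ** P) ** E"
proof -
  have "conj_transpose P ** E = E ** P" "conj_transpose Q ** E = E ** Q"
    using P Q by (simp_all add: hermitian_def conj_transpose_mult E)
  then show ?thesis
    by (metis conj_transpose_mult matrix_mul_assoc)
qed

text \<open>The first alternative means equal ranges, the second equal kernels. In the first,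
  \<open>E Q = E P Q = (Q P)* E = P* E = E P\<close>; the second exchanges \<open>P\<close> and
  \<open>Q\<close> at both ends.\<close>

lemma hermitian_projector_unique:
  assumes E: "positive_definite E" and herm: "hermitian (E ** P)" "hermitian (E ** Q)"
    and PQ: "P ** Q = Q \<and> Q ** P = P \<or> P ** Q = P \<and> Q ** P = Q"
  shows "P = Q"
proof -
  have "conj_transpose P ** E = E ** P" "conj_transpose Q ** E = E ** Q"
    using herm by (simp_all add: hermitian_def conj_transpose_mult positive_definite_hermitian[OF E])
  then have "E ** P = E ** Q"
    using PQ hermitian_mult_swap[OF positive_definite_hermitian[OF E] herm] by metis
  then show ?thesis
    by (rule positive_definite_mult_cancel[OF E])
qed

text \<open>The projectors \<open>B ** Y\<close> and \<open>Y ** B\<close> trade places, and the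
  weight \<open>F\<close> passes to the other side as its inverse \<open>G\<close>.\<close>

lemma weighted_MP_inverse_conj_transpose:
  assumes F: "conj_transpose F = F" and G: "conj_transpose G = G" "F ** G = mat 1" "G ** F = mat 1"
  shows "is_weighted_MP_inverse (mat 1) F B Y \<longleftrightarrow>
    is_weighted_MP_inverse G (mat 1) (conj_transpose B) (conj_transpose Y)"
proof -
  have "B ** Y ** B = B \<longleftrightarrow> conj_transpose B ** conj_transpose Y ** conj_transpose B = conj_transpose B"
    "Y ** B ** Y = Y \<longleftrightarrow> conj_transpose Y ** conj_transpose B ** conj_transpose Y = conj_transpose Y"
    "hermitian (B ** Y) \<longleftrightarrow> hermitian (conj_transpose Y ** conj_transpose B)"
    unfolding hermitian_def
    by (metis conj_transpose_mult conj_transpose_conj_transpose matrix_mul_assoc)+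
  moreover have "hermitian (F ** Y ** B) \<longleftrightarrow> hermitian (G ** conj_transpose B ** conj_transpose Y)"
    using hermitian_conj_transpose_inverse_iff[OF assms, of "Y ** B"]
    by (simp add: conj_transpose_mult matrix_mul_assoc)
  ultimately show ?thesis
    unfolding is_weighted_MP_inverse_def by auto
qed

text \<open>\<open>B Y\<close> and \<open>B Z\<close> have the same range, \<open>Y B\<close> and
  \<open>Z B\<close> the same kernel; so \<open>Y = Y B Y = Y B Z = Z B Z = Z\<close>.\<close>

lemma is_weighted_MP_inverse_unique:
  assumes E: "positive_definite E" and F: "positive_definite F"
    and Y: "is_weighted_MP_inverse E F B Y" and Z: "is_weighted_MP_inverse E F B Z"
  shows "Y = Z"
proof -
  have "B ** Y = B ** Z"
    by (rule hermitian_projector_unique[OF E])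
       (use Y Z in \<open>simp_all add: is_weighted_MP_inverse_def matrix_mul_assoc\<close>)
  moreover have "Y ** B = Z ** B"
    by (rule hermitian_projector_unique[OF F])
       (use Y Z in \<open>simp_all add: is_weighted_MP_inverse_def matrix_mul_assoc[symmetric]\<close>)
  ultimately show ?thesis
    using Y Z unfolding is_weighted_MP_inverse_def by (metis matrix_mul_assoc)
qed

lemma is_weighted_MP_inverse_exists:
  assumes E: "positive_definite E" and F: "positive_definite F"
  shows "\<exists>Y. is_weighted_MP_inverse E F B Y"
proof -
  obtain Z where Z: "B ** Z ** B = B" "hermitian (E ** B ** Z)"
    using least_squares_inverse_exists[OF E] by blast
  obtain G where G: "positive_definite G" "F ** G = mat 1" "G ** F = mat 1"
    using positive_definite_inverse[OF F] .
  \<comment> \<open>The adjoint of a least squares inverse of \<open>B*\<close> for \<open>G\<close>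
    is an inner inverse \<open>U\<close> with \<open>F U B\<close> Hermitian.\<close>
  obtain V where V: "conj_transpose B ** V ** conj_transpose B = conj_transpose B"
      "hermitian (G ** conj_transpose B ** V)"
    using least_squares_inverse_exists[OF G(1)] by blast
  define U where "U = conj_transpose V"
  have U: "B ** U ** B = B"
    using arg_cong[OF V(1), of conj_transpose] by (simp add: U_def conj_transpose_mult matrix_mul_assoc)
  have FU: "hermitian (F ** (U ** B))"
    using hermitian_conj_transpose_inverse_iff[of F G "U ** B"] V(2) G F
    by (simp add: U_def conj_transpose_mult positive_definite_hermitian matrix_mul_assoc)
  \<comment> \<open>\<open>U B Z\<close> inherits its left projector from \<open>Z\<close> and its
    right projector from \<open>U\<close>.\<close>
  have BY: "B ** (U ** B ** Z) = B ** Z" and YB: "(U ** B ** Z) ** B = U ** B"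
    using U Z by (metis matrix_mul_assoc)+
  have "is_weighted_MP_inverse E F B (U ** B ** Z)"
    unfolding is_weighted_MP_inverse_def
    by (metis BY FU U YB Z(2) matrix_mul_assoc)
  then show ?thesis ..
qed

lemma ex1_weighted_MP_inverse:
  assumes "positive_definite E" "positive_definite F"
  shows "\<exists>!Y. is_weighted_MP_inverse E F B Y"
  using is_weighted_MP_inverse_exists is_weighted_MP_inverse_unique assms by metis

section \<open>Core-EP inverses with a free exponent\<close>

text \<open>The exponent is a parameter: the index gives the core-EP inverse, 1 the core inverse,
  and \<open>m\<close> is an intermediate stage.\<close>

definition core_EP_of_order :: "complex^'n^'n \<Rightarrow> nat \<Rightarrow> complex^'n^'n \<Rightarrow> complex^'n^'n \<Rightarrow> bool" where
  "core_EP_of_order E j A X \<longleftrightarrow>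
     X ** (A ^^\<^sub>m Suc j) = A ^^\<^sub>m j \<and> A ** (X ** X) = X \<and> hermitian (E ** A ** X)"

lemma is_weighted_core_EP_inverse_iff:
  "is_weighted_core_EP_inverse E A X \<longleftrightarrow> core_EP_of_order E (matrix_index A) A X"
  by (simp add: is_weighted_core_EP_inverse_def core_EP_of_order_def matrix_pow_2)

lemma is_weighted_core_inverse_iff:
  "is_weighted_core_inverse E B Y \<longleftrightarrow> core_EP_of_order E 1 B Y"
  by (simp add: is_weighted_core_inverse_def core_EP_of_order_def matrix_pow_2)

text \<open>Iterating \<open>X = A X X\<close> places the range of \<open>X\<close> inside that of
  every power of \<open>A\<close>.\<close>

lemma core_EP_range:
  assumes "A ** (X ** X) = X"
  shows "X = (A ^^\<^sub>m i) ** (X ^^\<^sub>m Suc i)"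
proof (induction i)
  case (Suc i)
  have "(A ^^\<^sub>m Suc i) ** (X ^^\<^sub>m Suc (Suc i)) = (A ^^\<^sub>m i) ** (A ** (X ** X)) ** (X ^^\<^sub>m i)"
    unfolding matrix_pow_Suc_right[of A i] by (simp add: matrix_mul_assoc)
  then show ?case
    using Suc assms by (simp add: matrix_mul_assoc[symmetric])
qed simp

text \<open>\<open>core_EP_range\<close> gives \<open>A Z = A^(j+1) Z^(j+1)\<close>, on which
  \<open>X\<close> cancels one factor \<open>A\<close>.\<close>

lemma core_EP_outer:
  assumes X: "core_EP_of_order E j A X" and Z: "A ** (Z ** Z) = Z"
  shows "X ** (A ** Z) = Z" "(A ** X) ** (A ** Z) = A ** Z"
proof -
  have "X ** (A ** Z) = X ** (A ^^\<^sub>m Suc j) ** (Z ^^\<^sub>m Suc j)"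
    by (metis Z core_EP_range matrix_mul_assoc matrix_pow.simps(2))
  also have "\<dots> = Z"
    by (metis X Z core_EP_of_order_def core_EP_range)
  finally show "X ** (A ** Z) = Z" .
  then show "(A ** X) ** (A ** Z) = A ** Z"
    by (metis matrix_mul_assoc)
qed

text \<open>\<open>A X\<close> and \<open>A Z\<close> are self-adjoint projectors with the same
  range; then \<open>X = X A X = X A Z = Z\<close>.\<close>

lemma core_EP_unique:
  assumes E: "positive_definite E"
    and X: "core_EP_of_order E j A X" and Z: "core_EP_of_order E j A Z"
  shows "X = Z"
proof -
  have XX: "A ** (X ** X) = X" and ZZ: "A ** (Z ** Z) = Z"
    using X Z by (simp_all add: core_EP_of_order_def)
  have "A ** X = A ** Z"
    using X Z core_EP_outer(2)[OF X ZZ] core_EP_outer(2)[OF Z XX]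
    by (intro hermitian_projector_unique[OF E]) (simp_all add: core_EP_of_order_def matrix_mul_assoc)
  then show ?thesis
    by (metis X XX ZZ core_EP_outer(1))
qed

text \<open>For \<open>j = 1\<close> this makes a core inverse an inner inverse.\<close>

lemma core_EP_inner:
  assumes "core_EP_of_order E j A X"
  shows "A ** X ** (A ^^\<^sub>m j) = A ^^\<^sub>m j"
  using assms unfolding core_EP_of_order_def
  by (metis matrix_mul_assoc matrix_pow.simps(2))

text \<open>Left stability yields the first equation. Right stability shows that
  \<open>A X = A^(m+1) Y\<close> fixes \<open>A^m\<close>, hence also
  \<open>X = A^m Y\<close>.\<close>

lemma core_EP_of_least_squares_inverse:
  assumes T: "A ^^\<^sub>m m = T ** (A ^^\<^sub>m Suc m)"
    and Y: "(A ^^\<^sub>m Suc m) ** Y ** (A ^^\<^sub>m Suc m) = A ^^\<^sub>m Suc m" "hermitian (E ** (A ^^\<^sub>m Suc m) ** Y)"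
  shows "core_EP_of_order E m A ((A ^^\<^sub>m m) ** Y)"
proof -
  obtain S where S: "A ^^\<^sub>m m = (A ^^\<^sub>m Suc m) ** S"
    using left_stable_imp_right_stable[OF T] by blast
  have "(A ^^\<^sub>m m) ** Y ** (A ^^\<^sub>m Suc m) = A ^^\<^sub>m m"
    by (metis T Y(1) matrix_mul_assoc)
  moreover have AX: "A ** ((A ^^\<^sub>m m) ** Y) = (A ^^\<^sub>m Suc m) ** Y"
    by (simp add: matrix_mul_assoc)
  moreover have "(A ^^\<^sub>m Suc m) ** Y ** (A ^^\<^sub>m m) = A ^^\<^sub>m m"
    by (metis S Y(1) matrix_mul_assoc)
  ultimately show ?thesis
    unfolding core_EP_of_order_def using Y(2) by (metis matrix_mul_assoc)
qed

lemma core_EP_lower_order: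
  assumes X: "core_EP_of_order E m A X" and "matrix_index A \<le> m"
  shows "core_EP_of_order E (matrix_index A) A X"
proof -
  let ?k = "matrix_index A"
  \<comment> \<open>Iterated right stability comes from \<open>left_stable_add\<close> for the
    transpose and gives \<open>A^k = A^m R\<close>, with \<open>k\<close> the index.\<close>
  obtain S where "transpose A ^^\<^sub>m ?k = S ** (transpose A ^^\<^sub>m Suc ?k)"
    using left_stable_iff_right_stable left_stable_matrix_index[of A ?k]
      right_stable_transpose[of A ?k] by (metis order_refl)
  then obtain R where "A ^^\<^sub>m ?k = (A ^^\<^sub>m m) ** R"
    using left_stable_add[of "transpose A" ?k S "m - ?k"] assms(2)
    by (metis le_add_diff_inverse matrix_transpose_mul transpose_matrix_pow transpose_transpose)
  then have "X ** (A ^^\<^sub>m Suc ?k) = A ^^\<^sub>m ?k"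
    using X unfolding core_EP_of_order_def by (metis matrix_mul_assoc matrix_pow.simps(2))
  then show ?thesis
    using X by (simp add: core_EP_of_order_def)
qed

lemma weighted_core_EP_inverse_eqI:
  assumes E: "positive_definite E" and m: "matrix_index A \<le> m"
    and Y: "(A ^^\<^sub>m Suc m) ** Y ** (A ^^\<^sub>m Suc m) = A ^^\<^sub>m Suc m" "hermitian (E ** (A ^^\<^sub>m Suc m) ** Y)"
  shows "(\<exists>!X. is_weighted_core_EP_inverse E A X) \<and> weighted_core_EP_inverse E A = (A ^^\<^sub>m m) ** Y"
proof -
  have "is_weighted_core_EP_inverse E A ((A ^^\<^sub>m m) ** Y)"
    unfolding is_weighted_core_EP_inverse_iff
    using left_stable_matrix_index[OF m] core_EP_of_least_squares_inverse Y core_EP_lower_order m by metis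
  then show ?thesis
    unfolding weighted_core_EP_inverse_def
    by (metis E core_EP_unique is_weighted_core_EP_inverse_iff the_equality)
qed

text \<open>The hypothesis is left stability at exponent 1, so a least squares inverse
  \<open>Z\<close> of \<open>B^2\<close> gives the core inverse \<open>B Z\<close>.\<close>

lemma ex1_weighted_core_inverse:
  assumes E: "positive_definite E" and B: "B = T ** (B ** B)"
  shows "\<exists>!Y. is_weighted_core_inverse E B Y"
proof -
  obtain Z where "(B ^^\<^sub>m Suc 1) ** Z ** (B ^^\<^sub>m Suc 1) = B ^^\<^sub>m Suc 1" "hermitian (E ** (B ^^\<^sub>m Suc 1) ** Z)"
    using least_squares_inverse_exists[OF E] by blast
  then have "core_EP_of_order E 1 B ((B ^^\<^sub>m 1) ** Z)"
    by (intro core_EP_of_least_squares_inverse[where T = T]) (use B in simp_all)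
  then show ?thesis
    unfolding is_weighted_core_inverse_iff using core_EP_unique[OF E] by blast
qed

section \<open>The representation of the core-EP inverse\<close>

lemma core_EP_representation:
  assumes E: "positive_definite E" and m: "matrix_index A \<le> m"
  defines "B \<equiv> A ^^\<^sub>m Suc m"
  shows "(\<exists>!X. is_weighted_core_EP_inverse E A X) \<and>
      (\<exists>!Y. is_weighted_core_inverse E B Y) \<and>
      (\<exists>!Y. is_weighted_MP_inverse E (mat 1) B Y) \<and>
      weighted_core_EP_inverse E A = (A ^^\<^sub>m m) ** weighted_core_inverse E B \<and>
      (A ^^\<^sub>m m) ** weighted_core_inverse E B = (A ^^\<^sub>m m) ** weighted_MP_inverse E (mat 1) B"
proof -
  obtain T where T: "A ^^\<^sub>m m = T ** (A ^^\<^sub>m Suc m)"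
    using left_stable_matrix_index[OF m] by blast
  \<comment> \<open>Adding \<open>m + 2\<close> factors to \<open>A^m\<close> reaches exponent
    \<open>2 (m + 1)\<close>, that is \<open>B B\<close>; this is left stability of \<open>B\<close>
    at exponent 1.\<close>
  have "B = A ** (T ^^\<^sub>m (m + 2)) ** (A ^^\<^sub>m (m + (m + 2)))"
    using left_stable_add[OF T, of "m + 2"] by (simp add: B_def matrix_mul_assoc[symmetric])
  also have "A ^^\<^sub>m (m + (m + 2)) = B ** B"
    by (simp add: B_def matrix_pow_add[symmetric] del: matrix_pow.simps)
  finally have core: "\<exists>!Y. is_weighted_core_inverse E B Y"
    by (rule ex1_weighted_core_inverse[OF E])
  have MP: "\<exists>!Y. is_weighted_MP_inverse E (mat 1) B Y"
    by (rule ex1_weighted_MP_inverse[OF E positive_definite_mat_1])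
  have "is_weighted_core_inverse E B (weighted_core_inverse E B)"
    unfolding weighted_core_inverse_def by (rule theI'[OF core])
  then have "B ** weighted_core_inverse E B ** B = B" "hermitian (E ** B ** weighted_core_inverse E B)"
    using core_EP_inner unfolding is_weighted_core_inverse_iff
    by (fastforce simp: core_EP_of_order_def)+
  note 1 = weighted_core_EP_inverse_eqI[OF E m this[unfolded B_def]]
  have "is_weighted_MP_inverse E (mat 1) B (weighted_MP_inverse E (mat 1) B)"
    unfolding weighted_MP_inverse_def by (rule theI'[OF MP])
  then have "B ** weighted_MP_inverse E (mat 1) B ** B = B"
      "hermitian (E ** B ** weighted_MP_inverse E (mat 1) B)"
    by (simp_all add: is_weighted_MP_inverse_def)
  note 2 = weighted_core_EP_inverse_eqI[OF E m this[unfolded B_def]]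
  show ?thesis
    using 1 2 core MP by (simp only: B_def)
qed

section \<open>Duality by conjugate transposition\<close>

lemma ex1_the_conj_transpose:
  assumes "\<exists>!Y. P Y" and "\<And>Y. Q Y \<longleftrightarrow> P (conj_transpose Y)"
  shows "(\<exists>!Y. Q Y) \<and> (THE Y. Q Y) = conj_transpose (THE Y. P Y)"
proof -
  have "Q (conj_transpose (THE Y. P Y))"
    using theI'[OF assms(1)] assms(2) by simp
  moreover have "Y = conj_transpose (THE Y. P Y)" if "Q Y" for Y
    using that assms by (metis conj_transpose_conj_transpose the1_equality)
  ultimately show ?thesis
    by (metis the_equality)
qed

lemma dual_core_EP_representation:
  fixes F A :: "complex^'n^'n"
  assumes F: "positive_definite F" and m: "matrix_index A \<le> m"
  defines "B \<equiv> A ^^\<^sub>m Suc m"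
  shows "(\<exists>!X. is_weighted_dual_core_EP_inverse F A X) \<and>
      (\<exists>!Y. is_weighted_dual_core_inverse F B Y) \<and>
      (\<exists>!Y. is_weighted_MP_inverse (mat 1) F B Y) \<and>
      weighted_dual_core_EP_inverse F A = weighted_dual_core_inverse F B ** (A ^^\<^sub>m m) \<and>
      weighted_dual_core_inverse F B ** (A ^^\<^sub>m m) = weighted_MP_inverse (mat 1) F B ** (A ^^\<^sub>m m)"
proof -
  let ?H = conj_transpose
  obtain G where G: "positive_definite G" "F ** G = mat 1" "G ** F = mat 1"
    using positive_definite_inverse[OF F] .
  note FG = positive_definite_hermitian[OF F] positive_definite_hermitian[OF G(1)] G(2,3)
  have herm: "hermitian (F ** X ** M) \<longleftrightarrow> hermitian (G ** ?H M ** ?H X)" for X M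
    using hermitian_conj_transpose_inverse_iff[OF FG, of "X ** M"]
    by (simp add: conj_transpose_mult matrix_mul_assoc)
  have flip: "P ** Q = R \<longleftrightarrow> ?H Q ** ?H P = ?H R" for P Q R
    by (metis conj_transpose_mult conj_transpose_conj_transpose)
  have ep: "is_weighted_dual_core_EP_inverse F A X \<longleftrightarrow> is_weighted_core_EP_inverse G (?H A) (?H X)" for X
    unfolding is_weighted_dual_core_EP_inverse_def is_weighted_core_EP_inverse_def
      matrix_index_conj_transpose herm
    \<comment> \<open>\<open>flip\<close> applies to its own result; requiring a power as left
      factor transposes each equation just once.\<close>
    by (simp only: flip[of "A ^^\<^sub>m _"] flip[of "X ^^\<^sub>m _"] conj_transpose_matrix_pow)
  have core: "is_weighted_dual_core_inverse F M X \<longleftrightarrow> is_weighted_core_inverse G (?H M) (?H X)" for M X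
    unfolding is_weighted_dual_core_inverse_def is_weighted_core_inverse_def herm
    by (simp only: flip[of "M ^^\<^sub>m _"] flip[of "X ^^\<^sub>m _"] conj_transpose_matrix_pow)
  note MP = weighted_MP_inverse_conj_transpose[OF FG]
  have HB: "?H A ^^\<^sub>m Suc m = ?H B"
    by (simp only: B_def conj_transpose_matrix_pow)
  have rep: "(\<exists>!X. is_weighted_core_EP_inverse G (?H A) X) \<and>
      (\<exists>!Y. is_weighted_core_inverse G (?H B) Y) \<and>
      (\<exists>!Y. is_weighted_MP_inverse G (mat 1) (?H B) Y) \<and>
      weighted_core_EP_inverse G (?H A) = ?H (A ^^\<^sub>m m) ** weighted_core_inverse G (?H B) \<and>
      ?H (A ^^\<^sub>m m) ** weighted_core_inverse G (?H B) = ?H (A ^^\<^sub>m m) ** weighted_MP_inverse G (mat 1) (?H B)"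
    using core_EP_representation[OF G(1), of "?H A" m] m
    unfolding matrix_index_conj_transpose HB conj_transpose_matrix_pow[of A m] by blast
  have 1: "(\<exists>!X. is_weighted_dual_core_EP_inverse F A X) \<and>
      weighted_dual_core_EP_inverse F A = ?H (weighted_core_EP_inverse G (?H A))"
    unfolding weighted_dual_core_EP_inverse_def weighted_core_EP_inverse_def
    by (rule ex1_the_conj_transpose) (use rep ep in auto)
  have 2: "(\<exists>!X. is_weighted_dual_core_inverse F B X) \<and>
      weighted_dual_core_inverse F B = ?H (weighted_core_inverse G (?H B))"
    unfolding weighted_dual_core_inverse_def weighted_core_inverse_def
    by (rule ex1_the_conj_transpose) (use rep core in auto)
  have 3: "(\<exists>!X. is_weighted_MP_inverse (mat 1) F B X) \<and>
      weighted_MP_inverse (mat 1) F B = ?H (weighted_MP_inverse G (mat 1) (?H B))"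
    unfolding weighted_MP_inverse_def
    by (rule ex1_the_conj_transpose) (use rep MP in auto)
  have "?H Z ** (A ^^\<^sub>m m) = ?H (?H (A ^^\<^sub>m m) ** Z)" for Z :: "complex^'n^'n"
    by (simp add: conj_transpose_mult)
  then show ?thesis
    using 1 2 3 rep by simp
qed

theorem proposition3p16:
  fixes E F A :: "complex^'n^'n" and k m :: nat
  assumes "positive_definite E" and "positive_definite F"
    and "matrix_index A = k"
    and "m > 0" and "m \<ge> k"
  shows
    "((\<exists>!X. is_weighted_core_EP_inverse E A X) \<and>
      (\<exists>!Y. is_weighted_core_inverse E (A ^^\<^sub>m (m + 1)) Y) \<and>
      (\<exists>!Y. is_weighted_MP_inverse E (mat 1) (A ^^\<^sub>m (m + 1)) Y) \<and>
      weighted_core_EP_inverse E A = (A ^^\<^sub>m m) ** weighted_core_inverse E (A ^^\<^sub>m (m + 1)) \<and>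
      (A ^^\<^sub>m m) ** weighted_core_inverse E (A ^^\<^sub>m (m + 1)) =
        (A ^^\<^sub>m m) ** weighted_MP_inverse E (mat 1) (A ^^\<^sub>m (m + 1)))
     \<and>
     ((\<exists>!X. is_weighted_dual_core_EP_inverse F A X) \<and>
      (\<exists>!Y. is_weighted_dual_core_inverse F (A ^^\<^sub>m (m + 1)) Y) \<and>
      (\<exists>!Y. is_weighted_MP_inverse (mat 1) F (A ^^\<^sub>m (m + 1)) Y) \<and>
      weighted_dual_core_EP_inverse F A = weighted_dual_core_inverse F (A ^^\<^sub>m (m + 1)) ** (A ^^\<^sub>m m) \<and>
      weighted_dual_core_inverse F (A ^^\<^sub>m (m + 1)) ** (A ^^\<^sub>m m) =
        weighted_MP_inverse (mat 1) F (A ^^\<^sub>m (m + 1)) ** (A ^^\<^sub>m m))"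
  using core_EP_representation[of E A m] dual_core_EP_representation[of F A m] assms
  unfolding Suc_eq_plus1 by blast

end
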